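(* Let $K$ be a field and let $n \ge 3$. Let $\Omega, \Psi \subseteq \mathrm{M}(n,K)$ be similarity classes of $n\times n$ matrices over $K$, and assume that both $\Omega$ and $\Psi$ are nonscalar. Then $\{\operatorname{tr}(\omega\psi) : \omega \in \Omega,\ \psi \in \Psi\} = K$.
   Context: $\mathrm{M}(n,K)$ denotes the set of $n\times n$ matrices over the field $K$. A similarity class of $\mathrm{M}(n,K)$ is an orbit of $\mathrm{M}(n,K)$ under conjugation by $\mathrm{GL}(n,K)$; its elements need not be invertible. A class is nonscalar if its elements are not scalar multiples of the identity matrix. *)

theory Defs
  imports "Jordan_Normal_Form.Matrix"
begin

definition mat_trace :: "'a :: comm_monoid_add mat \<Rightarrow> 'a" where
  "mat_trace A = (\<Sum>i<dim_row A. A $$ (i, i))"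

(* Orbits of M(n,K) under conjugation by GL(n,K).  Since similar_mat A B forces B to be a
   square matrix of the same size as A, the orbit is contained in carrier_mat n n. *)
definition similarity_class :: "nat \<Rightarrow> 'a :: field mat set \<Rightarrow> bool" where
  "similarity_class n \<Omega> \<longleftrightarrow> (\<exists>A \<in> carrier_mat n n. \<Omega> = {B. similar_mat A B})"

definition nonscalar_class :: "nat \<Rightarrow> 'a :: field mat set \<Rightarrow> bool" where
  "nonscalar_class n \<Omega> \<longleftrightarrow> (\<forall>A \<in> \<Omega>. \<forall>c. A \<noteq> c \<cdot>\<^sub>m 1\<^sub>m n)"

end

theory Submission
  imports Defs "Jordan_Normal_Form.Determinant"
begin

text \<open>
  A nonscalar matrix has a vector \<open>v\<close> such that \<open>v\<close> and \<open>A v\<close> are independent. Hence \<open>A\<close> may be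
  taken with \<open>A e\<^sub>0 = e\<^sub>1\<close> and \<open>B\<close> with \<open>B e\<^sub>0 = e\<^sub>2\<close>, and a further transvection makes
  \<open>B\<^sub>2\<^sub>1 - A\<^sub>2\<^sub>2 = 1\<close>. Conjugating \<open>B\<close> with \<open>1 + t E\<^sub>0\<^sub>2\<close> changes the trace of \<open>A B\<close> by
  \<open>t (B A - A B)\<^sub>2\<^sub>0 - t\<^sup>2 A\<^sub>2\<^sub>0 B\<^sub>2\<^sub>0\<close>. Since \<open>A\<^sub>2\<^sub>0 = 0\<close>, this is linear in \<open>t\<close> with slope
  \<open>B\<^sub>2\<^sub>1 - A\<^sub>2\<^sub>2 = 1\<close>, so all traces occur.
\<close>

lemma mult_mat_index_sum:
  assumes "A \<in> carrier_mat n m" "B \<in> carrier_mat m p" "i < n" "k < p"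
  shows "(A * B) $$ (i, k) = (\<Sum>l<m. A $$ (i, l) * B $$ (l, k))"
  using assms by (auto simp: scalar_prod_def lessThan_atLeast0)

text \<open>Only a diagonal \<open>A\<close> needs work. Being nonscalar, it has two distinct
  diagonal entries, and conjugation with a transvection moves their difference off the
  diagonal.\<close>

lemma nonscalar_similar_offdiag_nonzero:
  fixes A :: "'a :: comm_ring_1 mat"
  assumes A: "A \<in> carrier_mat n n" and "\<And>c. A \<noteq> c \<cdot>\<^sub>m 1\<^sub>m n"
  obtains B i k where "similar_mat A B" "B \<in> carrier_mat n n"
    "i < n" "k < n" "i \<noteq> k" "B $$ (i, k) \<noteq> 0"
proof (cases "\<exists>i k. i < n \<and> k < n \<and> i \<noteq> k \<and> A $$ (i, k) \<noteq> 0")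
  case True
  then show ?thesis using that similar_mat_refl[OF A] A by blast
next
  case False
  have "\<exists>i k. i < n \<and> k < n \<and> A $$ (i, i) \<noteq> A $$ (k, k)"
  proof (rule ccontr)
    assume "\<not> ?thesis"
    then have diag: "A $$ (i, i) = A $$ (0, 0)" if "i < n" for i
      using that by (metis less_nat_zero_code neq0_conv)
    have "A = A $$ (0, 0) \<cdot>\<^sub>m 1\<^sub>m n"
    proof (rule eq_matI)
      fix i k assume "i < dim_row (A $$ (0, 0) \<cdot>\<^sub>m 1\<^sub>m n)" "k < dim_col (A $$ (0, 0) \<cdot>\<^sub>m 1\<^sub>m n)"
      then have "i < n" "k < n" by auto
      then show "A $$ (i, k) = (A $$ (0, 0) \<cdot>\<^sub>m 1\<^sub>m n) $$ (i, k)"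
        using False diag[of i] by (cases "i = k") auto
    qed (use A in auto)
    then show False using assms(2) by blast
  qed
  then obtain i k where ik: "i < n" "k < n" "A $$ (i, i) \<noteq> A $$ (k, k)" by blast
  then have "i \<noteq> k" by auto
  \<comment> \<open>This adds column \<open>i\<close> to column \<open>k\<close> and subtracts row
    \<open>k\<close> from row \<open>i\<close>.\<close>
  let ?B = "add_col_sub_row 1 i k A"
  have "?B $$ (i, k) = A $$ (i, i) - A $$ (k, k)"
  proof -
    have "A $$ (i, k) = 0" "A $$ (k, i) = 0" using False ik \<open>i \<noteq> k\<close> by auto
    then show ?thesis using A ik \<open>i \<noteq> k\<close> by simp
  qed
  then show ?thesis
    using that[of ?B i k] A ik \<open>i \<noteq> k\<close>
      similar_mat_sym[OF add_col_sub_row_similar[OF A ik(1,2) \<open>i \<noteq> k\<close>]]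
    by simp
qed

text \<open>Since A e_0 has a nonzero j-th coordinate, it can replace e_j in the standard basis. As
  j differs from 0, e_0 stays in the basis, and in the new basis A sends e_0 to the j-th basis
  vector.\<close>

lemma similar_first_col_unit:
  fixes A :: "'a :: field mat"
  assumes A: "A \<in> carrier_mat n n" and j: "0 < j" "j < n" and nz: "A $$ (j, 0) \<noteq> 0"
  obtains B where "similar_mat A B" "B \<in> carrier_mat n n"
    "\<And>i. i < n \<Longrightarrow> B $$ (i, 0) = (if i = j then 1 else 0)"
proof -
  let ?a = "\<lambda>i. A $$ (i, 0)"
  \<comment> \<open>\<open>P\<close> is the identity with column \<open>j\<close> replaced by A e_0;
    \<open>Q\<close> is its inverse, found by solving for e_j.\<close>
  define P where "P = mat n n (\<lambda>(i, k). if k = j then ?a i else if i = k then 1 else 0)"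
  define Q where "Q = mat n n (\<lambda>(i, k). if k = j then (if i = j then 1 / ?a j else - ?a i / ?a j)
    else if i = k then 1 else 0)"
  have carr: "P \<in> carrier_mat n n" "Q \<in> carrier_mat n n" by (auto simp: P_def Q_def)
  \<comment> \<open>This form of the entries of \<open>Q\<close> splits each product with \<open>Q\<close> into two Kronecker sums.\<close>
  have Q: "Q $$ (i, k) = (if i = k then 1 else 0)
      + (if k = j then ((if i = j then 1 else 0) - ?a i) / ?a j else 0)"
    if "i < n" "k < n" for i k
    using that j nz by (auto simp: Q_def field_simps)
  have QP: "Q * P = 1\<^sub>m n"
  proof (rule eq_matI)
    fix i k assume "i < dim_row (1\<^sub>m n :: 'a mat)" "k < dim_col (1\<^sub>m n :: 'a mat)"
    then have ik: "i < n" "k < n" by auto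
    have "(Q * P) $$ (i, k) = (\<Sum>l<n. Q $$ (i, l) * P $$ (l, k))"
      by (rule mult_mat_index_sum[OF carr(2,1) ik])
    also have "\<dots> = (\<Sum>l<n. (if l = i then P $$ (i, k) else 0)
      + (if l = j then ((if i = j then 1 else 0) - ?a i) / ?a j * P $$ (j, k) else 0))"
      using Q ik by (intro sum.cong) (auto simp: algebra_simps)
    also have "\<dots> = P $$ (i, k) + ((if i = j then 1 else 0) - ?a i) / ?a j * P $$ (j, k)"
      using ik j by (simp add: sum.distrib)
    also have "\<dots> = 1\<^sub>m n $$ (i, k)"
      using ik j nz by (auto simp: P_def field_simps)
    finally show "(Q * P) $$ (i, k) = 1\<^sub>m n $$ (i, k)" .
  qed (use carr in auto)
  have PQ: "P * Q = 1\<^sub>m n" by (rule mat_mult_left_right_inverse[OF carr(2,1) QP])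
  let ?B = "Q * A * P"
  have "similar_mat ?B A"
    by (rule similar_matI[of _ _ Q P n]) (use A carr PQ QP in auto)
  moreover have "?B $$ (i, 0) = (if i = j then 1 else 0)" if i: "i < n" for i
  proof -
    have "?B $$ (i, 0) = (\<Sum>l<n. (Q * A) $$ (i, l) * P $$ (l, 0))"
      by (rule mult_mat_index_sum[of _ n _ _ n]) (use carr A i j in auto)
    \<comment> \<open>Column 0 of \<open>P\<close> is still e_0, because \<open>j\<close> is
      positive.\<close>
    also have "\<dots> = (\<Sum>l<n. if l = 0 then (Q * A) $$ (i, 0) else 0)"
      using j by (intro sum.cong) (auto simp: P_def)
    also have "\<dots> = (Q * A) $$ (i, 0)" using j by simp
    also have "\<dots> = (\<Sum>l<n. Q $$ (i, l) * ?a l)"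
      by (rule mult_mat_index_sum[of _ n _ _ n]) (use carr A i j in auto)
    also have "\<dots> = (\<Sum>l<n. (if l = i then ?a i else 0)
      + (if l = j then ((if i = j then 1 else 0) - ?a i) / ?a j * ?a j else 0))"
      using Q i by (intro sum.cong) (auto simp: algebra_simps)
    also have "\<dots> = ?a i + ((if i = j then 1 else 0) - ?a i) / ?a j * ?a j"
      using i j by (simp add: sum.distrib)
    also have "\<dots> = (if i = j then 1 else 0)" using nz by simp
    finally show ?thesis .
  qed
  ultimately show ?thesis using that[of ?B] carr A similar_mat_sym by auto
qed

text \<open>Simultaneous row and column swaps bring a nonzero off-diagonal entry to position (j, 0),
  where the change of basis above applies.\<close>

lemma nonscalar_similar_first_col_unit:
  fixes A :: "'a :: field mat"
  assumes A: "A \<in> carrier_mat n n" and "\<And>c. A \<noteq> c \<cdot>\<^sub>m 1\<^sub>m n" and j: "0 < j" "j < n"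
  obtains B where "similar_mat A B" "B \<in> carrier_mat n n"
    "\<And>i. i < n \<Longrightarrow> B $$ (i, 0) = (if i = j then 1 else 0)"
proof -
  obtain C i k where C: "similar_mat A C" "C \<in> carrier_mat n n" and
    ik: "i < n" "k < n" "i \<noteq> k" "C $$ (i, k) \<noteq> 0"
    using nonscalar_similar_offdiag_nonzero[OF assms(1,2)] by blast
  define D where "D = swap_cols_rows k 0 C"
  \<comment> \<open>The swap of \<open>k\<close> and 0 sends row 0 to row \<open>k\<close> and fixes
    every other row \<open>i\<close>, as \<open>i\<close> differs from \<open>k\<close>. So the
    nonzero entry lands at \<open>(i', 0)\<close>, below the diagonal.\<close>
  define i' where "i' = (if i = 0 then k else i)"
  have D: "D \<in> carrier_mat n n" "similar_mat C D"
    using C j similar_mat_sym[OF swap_cols_rows_similar[OF C(2) ik(2), of 0]]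
    by (auto simp: D_def)
  have i': "i' < n" "i' \<noteq> 0" "D $$ (i', 0) \<noteq> 0"
    using ik C j by (auto simp: i'_def D_def)
  \<comment> \<open>Both \<open>i'\<close> and \<open>j\<close> are nonzero, so this swap leaves
    column 0 in place.\<close>
  define E where "E = swap_cols_rows i' j D"
  have E: "E \<in> carrier_mat n n" "similar_mat D E"
    using D j similar_mat_sym[OF swap_cols_rows_similar[OF D(1) i'(1) j(2)]]
    by (auto simp: E_def)
  have "E $$ (j, 0) \<noteq> 0"
    using i' D j by (auto simp: E_def)
  then obtain B where "similar_mat E B" "B \<in> carrier_mat n n"
    "\<And>i. i < n \<Longrightarrow> B $$ (i, 0) = (if i = j then 1 else 0)"
    using similar_first_col_unit[OF E(1) j] by blast
  moreover from this have "similar_mat A B"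
    using C D E similar_mat_trans by blast
  ultimately show ?thesis using that by blast
qed

lemma mat_trace_mult:
  assumes "A \<in> carrier_mat n m" "B \<in> carrier_mat m n"
  shows "mat_trace (A * B) = (\<Sum>i<n. \<Sum>k<m. A $$ (i, k) * B $$ (k, i))"
  using assms unfolding mat_trace_def by (intro sum.cong mult_mat_index_sum) auto

text \<open>With N = E_kl the conjugate is (1 - aN) B (1 + aN) = B + a(BN - NB) - a^2 NBN.
  Multiplying by A and taking traces, tr(XN) = X_lk gives the linear term, and tr(ANBN) = A_lk B_lk
  the quadratic one.\<close>

lemma mat_trace_mult_add_col_sub_row:
  fixes A B :: "'a :: comm_ring_1 mat"
  assumes A: "A \<in> carrier_mat n n" and B: "B \<in> carrier_mat n n"
    and kl: "k < n" "l < n" "k \<noteq> l"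
  shows "mat_trace (A * add_col_sub_row a k l B) = mat_trace (A * B)
    + a * ((A * B) $$ (l, k) - (B * A) $$ (l, k)) - a * a * (A $$ (l, k) * B $$ (l, k))"
proof -
  let ?C = "add_col_sub_row a k l B"
  have C: "?C $$ (p, i) = B $$ (p, i) - (if p = k then a * B $$ (l, i) else 0)
      + (if i = l then a * B $$ (p, k) else 0)
      - (if i = l then if p = k then a * a * B $$ (l, k) else 0 else 0)"
    if "i < n" "p < n" for i p
    using that B kl by (simp add: algebra_simps)
  have "mat_trace (A * ?C) = (\<Sum>i<n. \<Sum>p<n. A $$ (i, p) * ?C $$ (p, i))"
    using A B by (intro mat_trace_mult) auto
  also have "\<dots> = (\<Sum>i<n. \<Sum>p<n. A $$ (i, p) * B $$ (p, i)
      - (if p = k then a * (B $$ (l, i) * A $$ (i, k)) else 0)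
      + (if i = l then a * (A $$ (l, p) * B $$ (p, k)) else 0)
      - (if i = l then if p = k then a * a * (A $$ (l, k) * B $$ (l, k)) else 0 else 0))"
    by (intro sum.cong refl) (simp add: C ring_distribs mult.left_commute mult.commute)
  \<comment> \<open>The last two double sums are interchanged so that the condition
    \<open>i = l\<close> binds the inner index and the inner sum collapses.\<close>
  also have "\<dots> = (\<Sum>i<n. \<Sum>p<n. A $$ (i, p) * B $$ (p, i))
      - (\<Sum>i<n. \<Sum>p<n. if p = k then a * (B $$ (l, i) * A $$ (i, k)) else 0)
      + (\<Sum>p<n. \<Sum>i<n. if i = l then a * (A $$ (l, p) * B $$ (p, k)) else 0)
      - (\<Sum>p<n. \<Sum>i<n. if i = l then if p = k then a * a * (A $$ (l, k) * B $$ (l, k)) else 0 else 0)"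
    unfolding sum_subtractf sum.distrib
    by (intro arg_cong2[of _ _ _ _ "(+)"] arg_cong2[of _ _ _ _ "(-)"] refl sum.swap)
  also have "\<dots> = mat_trace (A * B) - a * (\<Sum>i<n. B $$ (l, i) * A $$ (i, k))
      + a * (\<Sum>p<n. A $$ (l, p) * B $$ (p, k)) - a * a * (A $$ (l, k) * B $$ (l, k))"
    using kl by (simp add: mat_trace_mult[OF A B] sum_distrib_left)
  also have "(\<Sum>i<n. B $$ (l, i) * A $$ (i, k)) = (B * A) $$ (l, k)"
    by (rule mult_mat_index_sum[symmetric]) (use A B kl in auto)
  also have "(\<Sum>p<n. A $$ (l, p) * B $$ (p, k)) = (A * B) $$ (l, k)"
    by (rule mult_mat_index_sum[symmetric]) (use A B kl in auto)
  finally show ?thesis by (simp add: algebra_simps)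
qed

lemma mult_index_unit_col:
  fixes A B :: "'a :: semiring_1 mat"
  assumes "A \<in> carrier_mat n n" "B \<in> carrier_mat n n" "i < n" "k < n" "j < n"
    and "\<And>p. p < n \<Longrightarrow> B $$ (p, k) = (if p = j then 1 else 0)"
  shows "(A * B) $$ (i, k) = A $$ (i, j)"
proof -
  have "(A * B) $$ (i, k) = (\<Sum>p<n. A $$ (i, p) * B $$ (p, k))"
    using assms by (intro mult_mat_index_sum) auto
  also have "\<dots> = (\<Sum>p<n. if p = j then A $$ (i, j) else 0)"
    using assms(6) by (intro sum.cong) auto
  finally show ?thesis using assms(5) by simp
qed

lemma similarity_class_similar:
  assumes "similarity_class n \<Omega>" "A \<in> \<Omega>" "similar_mat A B"
  shows "B \<in> \<Omega>"
  using assms similar_mat_trans unfolding similarity_class_def by blast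

text \<open>The index \<open>j\<close> is left free because the two classes receive representatives
  with different first columns.\<close>

lemma nonscalar_class_first_col_unit:
  assumes "similarity_class n \<Omega>" "nonscalar_class n \<Omega>" and j: "0 < j" "j < n"
  obtains A where "A \<in> \<Omega>" "A \<in> carrier_mat n n"
    "\<And>i. i < n \<Longrightarrow> A $$ (i, 0) = (if i = j then 1 else 0)"
proof -
  obtain C where C: "C \<in> carrier_mat n n" "C \<in> \<Omega>"
    using assms(1) similar_mat_refl unfolding similarity_class_def by blast
  have "C \<noteq> c \<cdot>\<^sub>m 1\<^sub>m n" for c
    using assms(2) C unfolding nonscalar_class_def by blast
  then show ?thesis
    using nonscalar_similar_first_col_unit[OF C(1) _ j] that
      similarity_class_similar[OF assms(1) C(2)] by metis
qed

theorem theorem1p1: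
  fixes \<Omega> \<Psi> :: "'a :: field mat set" and n :: nat
  assumes "n \<ge> 3"
    and "similarity_class n \<Omega>" and "similarity_class n \<Psi>"
    and "nonscalar_class n \<Omega>" and "nonscalar_class n \<Psi>"
  shows "{mat_trace (\<omega> * \<psi>) | \<omega> \<psi>. \<omega> \<in> \<Omega> \<and> \<psi> \<in> \<Psi>} = (UNIV :: 'a set)"
proof -
  have n: "0 < n" "1 < n" "2 < n" using assms(1) by auto
  obtain A where A: "A \<in> \<Omega>" "A \<in> carrier_mat n n"
    and A0: "\<And>i. i < n \<Longrightarrow> A $$ (i, 0) = (if i = 1 then 1 else 0)"
    using nonscalar_class_first_col_unit[OF assms(2,4), of 1] n by auto
  obtain C where C: "C \<in> \<Psi>" "C \<in> carrier_mat n n"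
    and C0: "\<And>i. i < n \<Longrightarrow> C $$ (i, 0) = (if i = 2 then 1 else 0)"
    using nonscalar_class_first_col_unit[OF assms(3,5), of 2] n by auto
  \<comment> \<open>Adding a times column 0 to column 1 raises the entry (2, 1) by a, as C_20 = 1.
    Subtracting a times row 1 from row 0 keeps the first column, as C_10 = 0.\<close>
  define B where "B = add_col_sub_row (A $$ (2, 2) + 1 - C $$ (2, 1)) 0 1 C"
  have B: "B \<in> carrier_mat n n" "B \<in> \<Psi>"
    using C n similarity_class_similar[OF assms(3) C(1)]
      similar_mat_sym[OF add_col_sub_row_similar[OF C(2) n(1,2)]]
    by (auto simp: B_def)
  have B0: "B $$ (i, 0) = (if i = 2 then 1 else 0)" if "i < n" for i
    using that C n C0 by (auto simp: B_def)
  have B21: "B $$ (2, 1) = A $$ (2, 2) + 1"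
    using C n C0 by (auto simp: B_def)
  have "x \<in> {mat_trace (\<omega> * \<psi>) | \<omega> \<psi>. \<omega> \<in> \<Omega> \<and> \<psi> \<in> \<Psi>}" for x
  proof -
    \<comment> \<open>For parameter a the trace becomes tr(AB) + a (A_22 - B_21) = tr(AB) - a, the
      quadratic term vanishing with A_20; solving for the value \<open>x\<close> gives this
      parameter.\<close>
    let ?D = "add_col_sub_row (mat_trace (A * B) - x) 0 2 B"
    have "(A * B) $$ (2, 0) = A $$ (2, 2)"
      by (rule mult_index_unit_col[OF A(2) B(1) n(3,1,3) B0])
    moreover have "(B * A) $$ (2, 0) = B $$ (2, 1)"
      by (rule mult_index_unit_col[OF B(1) A(2) n(3,1,2) A0])
    ultimately have "mat_trace (A * ?D) = x"
      using mat_trace_mult_add_col_sub_row[OF A(2) B(1) n(1,3)] A0 n B21 by simp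
    moreover have "?D \<in> \<Psi>"
      using similarity_class_similar[OF assms(3) B(2)]
        similar_mat_sym[OF add_col_sub_row_similar[OF B(1) n(1,3)]] by simp
    ultimately show ?thesis using A(1) unfolding mem_Collect_eq by metis
  qed
  then show ?thesis by blast
qed

end
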